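(* Let $m\ge 0$ and $n\ge1$ be integers. Then $$\frac1{n!}\sum_{\mathcal{S}\in\Pi_{[n]}}\frac{1}{\prod_{S\in\mathcal{S}}|S|}\,\mu(\mathcal{S})\,|\tau(\Gamma/\mathcal{S})|=\frac{1}{(m-1)n+1}\binom{mn}{n}.$$
   Context: $\Pi_{[n]}$ is the set of set partitions of $[n]=\{1,\dots,n\}$, and $\mu(\mathcal{S})=(-1)^{n-|\mathcal{S}|}\prod_{S\in\mathcal{S}}(|S|-1)!$. $\Gamma$ is the multigraph with vertex set $\{0,1,\dots,n\}$, with $m$ edges between $i$ and $j$ for every pair $i\ne j$ in $[n]$ and one edge between $0$ and $i$ for each $i\in[n]$. For $\mathcal{S}\in\Pi_{[n]}$, $\Gamma/\mathcal{S}$ is the multigraph obtained by contracting, for each block $S$ of $\mathcal{S}$, all vertices of $S$ to one vertex (vertex $0$ is never contracted). $\tau(H)$ denotes the set of spanning trees of a multigraph $H$.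
   Formalization: For m = 0, n = 1 the right-hand side is undefined (its denominator (m-1)n+1 is 0); there it is taken to be 1, the value of its polynomial continuation in m; all other cases are as stated. *)

theory Defs
  imports Complex_Main "HOL-Library.Disjoint_Sets"
begin

text \<open>
  Undirected multigraphs, with loops and parallel edges: \<open>ends H e\<close> is the set of endpoints
  of the edge \<open>e\<close>, which is a singleton exactly when \<open>e\<close> is a loop.
\<close>

record ('v, 'e) multigraph =
  vertices :: "'v set"
  edges :: "'e set"
  ends :: "'e \<Rightarrow> 'v set"

definition mg_adj :: "('v, 'e) multigraph \<Rightarrow> ('v \<times> 'v) set" where
  "mg_adj H = {(u, v). \<exists>e\<in>edges H. ends H e = {u, v}}"

definition mg_connected :: "('v, 'e) multigraph \<Rightarrow> bool" where
  "mg_connected H \<longleftrightarrow>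
     vertices H \<noteq> {} \<and> (\<forall>u\<in>vertices H. \<forall>v\<in>vertices H. (u, v) \<in> (mg_adj H)\<^sup>*)"

text \<open>
  A cycle of length \<open>k = length es\<close>. A loop is a cycle of length 1 and
  two parallel edges form a cycle of length 2; no edge may be used twice.
\<close>

definition mg_cycle :: "('v, 'e) multigraph \<Rightarrow> 'v list \<Rightarrow> 'e list \<Rightarrow> bool" where
  "mg_cycle H vs es \<longleftrightarrow>
     es \<noteq> [] \<and> length vs = length es \<and> distinct vs \<and> distinct es \<and>
     set vs \<subseteq> vertices H \<and> set es \<subseteq> edges H \<and>
     (\<forall>i<length es. ends H (es ! i) = {vs ! i, vs ! (Suc i mod length es)})"

definition mg_tree :: "('v, 'e) multigraph \<Rightarrow> bool" where
  "mg_tree H \<longleftrightarrow> mg_connected H \<and> (\<nexists>vs es. mg_cycle H vs es)"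

text \<open>
  A spanning tree is identified with its edge set, so spanning trees that differ only by a
  choice among parallel edges are distinct.
\<close>

definition spanning_trees :: "('v, 'e) multigraph \<Rightarrow> 'e set set" where
  "spanning_trees H = {T. T \<subseteq> edges H \<and> mg_tree (H\<lparr>edges := T\<rparr>)}"

text \<open>
  The vertex to which \<open>v\<close> is contracted. For a family \<open>P\<close> of disjoint blocks this is the block
  containing \<open>v\<close>, or \<open>{v}\<close> if no block contains \<open>v\<close>.
\<close>

definition merged_vertex :: "'v set set \<Rightarrow> 'v \<Rightarrow> 'v set" where
  "merged_vertex P v = insert v (\<Union>{B \<in> P. v \<in> B})"

lemma merged_vertex_in_block:
  assumes "disjoint P" "B \<in> P" "v \<in> B"
  shows "merged_vertex P v = B"
proof -
  have "{C \<in> P. v \<in> C} = {B}"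
    using assms by (auto simp: disjoint_def)
  then show ?thesis
    using assms by (auto simp: merged_vertex_def)
qed

lemma merged_vertex_not_in_block:
  "v \<notin> \<Union>P \<Longrightarrow> merged_vertex P v = {v}"
  by (auto simp: merged_vertex_def)

text \<open>All edges are kept: those inside a block become loops.\<close>

definition contract_blocks ::
    "('v, 'e) multigraph \<Rightarrow> 'v set set \<Rightarrow> ('v set, 'e) multigraph" where
  "contract_blocks H P =
     \<lparr>vertices = merged_vertex P ` vertices H,
      edges = edges H,
      ends = (\<lambda>e. merged_vertex P ` ends H e)\<rparr>"

text \<open>
  The edge \<open>(i, j, k)\<close> is the \<open>k\<close>-th of the parallel edges between \<open>i\<close> and \<open>j\<close>;
  requiring \<open>i < j\<close> counts every unordered pair once.
\<close>

definition Gamma_graph :: "nat \<Rightarrow> nat \<Rightarrow> (nat, nat \<times> nat \<times> nat) multigraph" where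
  "Gamma_graph m n =
     \<lparr>vertices = {0..n},
      edges = {(i, j, k). 1 \<le> i \<and> i < j \<and> j \<le> n \<and> k < m} \<union> {(0, i, 0) |i. i \<in> {1..n}},
      ends = (\<lambda>(i, j, k). {i, j})\<rparr>"

definition partition_mu :: "nat \<Rightarrow> nat set set \<Rightarrow> real" where
  "partition_mu n P = (-1) ^ (n - card P) * (\<Prod>S\<in>P. fact (card S - 1))"

text \<open>
  The right-hand side \<open>(mn choose n) / ((m-1)n+1)\<close>. For \<open>m = 0\<close>, \<open>n = 1\<close>, the only
  case with a vanishing denominator, the expression reads 0/0. For fixed \<open>n \<ge> 1\<close> it is a
  polynomial in \<open>m\<close>, namely \<open>(mn)(mn-1)\<dots>(mn-n+2) / n!\<close>, which is the constant 1 when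
  \<open>n = 1\<close>, and it is given that value.
\<close>

definition fuss_catalan :: "nat \<Rightarrow> nat \<Rightarrow> real" where
  "fuss_catalan m n =
     (if m = 0 \<and> n = 1 then 1
      else 1 / ((real m - 1) * real n + 1) * real ((m * n) choose n))"

end

theory Submission
  imports Defs "HOL-Library.FuncSet"
begin

text \<open>
  A spanning tree of \<open>\<Gamma>/P\<close> rooted at \<open>0\<close> is a choice, for every block \<open>B\<close>, of an edge to a parent;
  there are \<open>|B|\<close> edges from \<open>B\<close> to \<open>0\<close> and \<open>|B| \<cdot> m|C|\<close> from \<open>B\<close> to \<open>C\<close>. The factors \<open>|B|\<close> come out,
  and Cayley's formula with the vertex weights \<open>1\<close> at the root and \<open>m|C|\<close> at \<open>C\<close>, of total \<open>mn + 1\<close>,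
  gives \<open>(mn + 1)\<^bsup>|P| - 1\<^esup>\<close> for the remaining sum over parent maps. So the left-hand side is
  \<open>\<Sum>\<^sub>P \<mu>(P) x\<^bsup>|P|\<^esup> / (n! x)\<close> at \<open>x = mn + 1\<close>, and this sum over \<open>P\<close> is the falling factorial
  \<open>x(x - 1)\<dots>(x - n + 1)\<close>: a new element either forms a block, with factor \<open>x\<close>, or joins a
  block \<open>B\<close>, with factor \<open>-|B|\<close>.
\<close>

subsection \<open>Falling factorials as sums over partitions\<close>

text \<open>The share of one block of size \<open>s\<close> in
  \<open>partition_mu n P * x ^ card P\<close>; the sign splits into one factor
  \<open>(-1) ^ (s - 1)\<close> per block.\<close>

definition signed_block_weight :: "real \<Rightarrow> nat \<Rightarrow> real" where
  "signed_block_weight x s = x * (-1) ^ (s - 1) * fact (s - 1)"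

text \<open>For \<open>B = {}\<close> this adds the singleton block \<open>{a}\<close>.\<close>

definition add_to_block :: "'a \<Rightarrow> 'a set set \<Rightarrow> 'a set \<Rightarrow> 'a set set" where
  "add_to_block a Q B = insert (insert a B) (Q - {B})"

lemma partition_on_add_to_block:
  assumes Q: "partition_on A Q" and B: "B \<in> insert {} Q" and a: "a \<notin> A"
  shows "partition_on (insert a A) (add_to_block a Q B)"
proof -
  have BA: "B \<subseteq> A" and disj: "disjnt B (\<Union>(Q - {B}))"
    using Q B by (auto simp: partition_on_def disjoint_def disjnt_iff)
  have "insert B (Q - {B}) = insert B Q" by auto
  then have U: "\<Union>(Q - {B}) = A - B"
    using disj Q by (auto simp: partition_on_def disjnt_iff)
  have rest: "partition_on (A - B) (Q - {B})"
    using Q U by (auto simp: partition_on_def disjoint_def)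
  have "disjnt (insert a B) (\<Union>(Q - {B}))"
    using disj U a by (auto simp: disjnt_iff)
  moreover have "insert a A - insert a B = A - B" using a by auto
  ultimately show ?thesis
    using rest BA by (auto simp: add_to_block_def partition_on_insert)
qed

text \<open>The inverse deletes \<open>a\<close> from all blocks, drops an empty remainder and
  records what is left of the block of \<open>a\<close>. An empty record means that
  \<open>{a}\<close> was a block, unambiguously since partitions have no empty block.\<close>

lemma bij_betw_add_to_block:
  assumes a: "a \<notin> A"
  shows "bij_betw (\<lambda>(Q, B). add_to_block a Q B)
           (SIGMA Q:{Q. partition_on A Q}. insert {} Q) {P. partition_on (insert a A) P}"
proof (rule bij_betw_byWitness
    [where f' = "\<lambda>P. ((\<lambda>S. S - {a}) ` P - {{}}, \<Union>{S \<in> P. a \<in> S} - {a})"])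
  show "(\<lambda>(Q, B). add_to_block a Q B) ` (SIGMA Q:{Q. partition_on A Q}. insert {} Q)
      \<subseteq> {P. partition_on (insert a A) P}"
    using partition_on_add_to_block[OF _ _ a] by auto
next
  show "\<forall>QB\<in>SIGMA Q:{Q. partition_on A Q}. insert {} Q.
      (\<lambda>P. ((\<lambda>S. S - {a}) ` P - {{}}, \<Union>{S \<in> P. a \<in> S} - {a}))
        ((\<lambda>(Q, B). add_to_block a Q B) QB) = QB"
  proof clarify
    fix Q B assume Q: "partition_on A Q" and B: "B \<in> insert {} Q"
    have aQ: "a \<notin> S" if "S \<in> insert {} Q" for S
      using Q a that by (auto simp: partition_on_def)
    then have "(\<lambda>S. S - {a}) ` (Q - {B}) = Q - {B}" and "insert a B - {a} = B"
      using B by auto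
    then have 1: "(\<lambda>S. S - {a}) ` add_to_block a Q B = insert B Q"
      by (auto simp: add_to_block_def)
    have 2: "{S \<in> add_to_block a Q B. a \<in> S} = {insert a B}"
      using aQ by (auto simp: add_to_block_def)
    have "{} \<notin> Q" using Q by (simp add: partition_on_def)
    then show "(\<lambda>S. S - {a}) ` add_to_block a Q B - {{}} = Q \<and>
        \<Union>{S \<in> add_to_block a Q B. a \<in> S} - {a} = B"
      using 1 2 B aQ by auto
  qed
next
  have *: "\<exists>S\<in>P. a \<in> S \<and> {T \<in> P. a \<in> T} = {S} \<and> (\<forall>T\<in>P - {S}. a \<notin> T)"
    if P: "partition_on (insert a A) P" for P
  proof -
    obtain S where S: "S \<in> P" "a \<in> S" using partition_onD1[OF P] by blast
    have "T = S" if "T \<in> P" "a \<in> T" for T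
      using disjointD[OF partition_onD2[OF P] that(1) S(1)] that(2) S(2) by blast
    with S show ?thesis by blast
  qed
  show "\<forall>P\<in>{P. partition_on (insert a A) P}.
      (\<lambda>(Q, B). add_to_block a Q B) ((\<lambda>S. S - {a}) ` P - {{}}, \<Union>{S \<in> P. a \<in> S} - {a}) = P"
  proof clarify
    fix P assume P: "partition_on (insert a A) P"
    then obtain S where S: "S \<in> P" "a \<in> S" "{T \<in> P. a \<in> T} = {S}" "\<forall>T\<in>P - {S}. a \<notin> T"
      using * by blast
    have im: "(\<lambda>T. T - {a}) ` P = insert (S - {a}) (P - {S})"
    proof -
      have "(\<lambda>T. T - {a}) ` (P - {S}) = (\<lambda>T. T) ` (P - {S})"
        using S by (intro image_cong) auto
      then show ?thesis
        using image_insert[of "\<lambda>T. T - {a}" S "P - {S}"] S(1) by (simp add: insert_absorb)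
    qed
    \<comment> \<open>\<open>S - {a}\<close> is empty or meets \<open>S\<close>, so it is no other
      block of \<open>P\<close>; removing it from the shrunken partition leaves exactly
      \<open>P - {S}\<close>.\<close>
    have ne: "S - {a} \<notin> P - {S}"
    proof
      assume "S - {a} \<in> P - {S}"
      then have "(S - {a}) \<inter> S = {}" and "S - {a} \<noteq> {}"
        using disjointD[OF partition_onD2[OF P], of "S - {a}" S] S(1) partition_onD3[OF P]
        by (blast, metis DiffD1)
      then show False by blast
    qed
    have e: "{} \<notin> P" using P by (simp add: partition_on_def)
    have "insert (S - {a}) (P - {S}) - {{}} - {S - {a}} = P - {S}"
      using ne e by auto
    then show "add_to_block a ((\<lambda>S. S - {a}) ` P - {{}}) (\<Union>{S \<in> P. a \<in> S} - {a}) = P"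
      using S(1,2) by (simp add: add_to_block_def im S(3) insert_absorb)
  qed
  show "(\<lambda>P. ((\<lambda>S. S - {a}) ` P - {{}}, \<Union>{S \<in> P. a \<in> S} - {a})) ` {P. partition_on (insert a A) P}
      \<subseteq> (SIGMA Q:{Q. partition_on A Q}. insert {} Q)"
  proof clarify
    fix P assume P: "partition_on (insert a A) P"
    then obtain S where S: "S \<in> P" "a \<in> S" "{T \<in> P. a \<in> T} = {S}"
      using * by blast
    have "(\<lambda>T. T - {a}) ` P = (\<inter>) (- {a}) ` P" by (intro image_cong) auto
    moreover have "partition_on A ((\<inter>) (- {a}) ` P - {{}})"
      using partition_on_restrict[OF P, of "- {a}"] a by (simp add: Diff_eq[symmetric] Int_commute)
    ultimately show "(\<lambda>S. S - {a}) ` P - {{}} \<in> {Q. partition_on A Q} \<and>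
        \<Union>{S \<in> P. a \<in> S} - {a} \<in> insert {} ((\<lambda>S. S - {a}) ` P - {{}})"
      using S(1) by (auto simp: S(3))
  qed
qed

text \<open>Extending \<open>Q\<close> by \<open>a\<close> multiplies its weight by \<open>x\<close>
  (new block) or by \<open>- card B\<close> (joining \<open>B\<close>). Block sizes add up to
  \<open>card A\<close>, so these factors total \<open>x - card A\<close> whatever \<open>Q\<close>
  is: one new factor per induction step.\<close>

lemma sum_partition_on_signed_block_weight:
  assumes "finite A"
  shows "(\<Sum>P | partition_on A P. \<Prod>S\<in>P. signed_block_weight x (card S))
    = (\<Prod>i<card A. x - real i)"
  using assms
proof (induction A rule: finite_induct)
  case empty
  then show ?case by (simp add: partition_on_empty)
next
  case (insert a A)
  let ?w = "\<lambda>P. \<Prod>S\<in>P. signed_block_weight x (card S)"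
  have inner: "(\<Sum>B\<in>insert {} Q. ?w (add_to_block a Q B)) = (x - real (card A)) * ?w Q"
    if Q: "partition_on A Q" for Q
  proof -
    have fQ: "finite Q" and fB: "\<And>B. B \<in> Q \<Longrightarrow> finite B" and e: "{} \<notin> Q"
      and aB: "\<And>B. B \<in> insert {} Q \<Longrightarrow> a \<notin> B"
      using finite_elements[OF insert.hyps(1) Q] Q insert.hyps
      by (auto simp: partition_on_def intro: finite_subset[of _ "\<Union> Q"])
    have w: "?w (add_to_block a Q B) = signed_block_weight x (Suc (card B)) * ?w (Q - {B})"
      if "B \<in> insert {} Q" for B
    proof -
      have "finite B" using that fB by auto
      have "insert a B \<notin> Q - {B}" using aB by blast
      then show ?thesis using fQ \<open>finite B\<close> aB[OF that] by (simp add: add_to_block_def)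
    qed
    have "?w (add_to_block a Q B) = - real (card B) * ?w Q" if B: "B \<in> Q" for B
    proof -
      \<comment> \<open>Truncated subtraction gives sizes 0 and 1 the same weight, so the factor
        \<open>- s\<close> from size \<open>s\<close> to \<open>s + 1\<close> relies on
        \<open>s > 0\<close>.\<close>
      have "card B > 0" using B fB e by (metis card_gt_0_iff)
      then have "signed_block_weight x (Suc (card B)) = - real (card B) * signed_block_weight x (card B)"
        by (cases "card B") (simp_all add: signed_block_weight_def algebra_simps)
      then show ?thesis using w[of B] B prod.remove[OF fQ B, of "\<lambda>S. signed_block_weight x (card S)"] by simp
    qed
    moreover have "?w (add_to_block a Q {}) = x * ?w Q"
      using w[of "{}"] e by (simp add: signed_block_weight_def)
    ultimately have "(\<Sum>B\<in>insert {} Q. ?w (add_to_block a Q B)) = x * ?w Q - (\<Sum>B\<in>Q. real (card B) * ?w Q)"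
      using fQ e by (simp add: sum_negf)
    moreover have "(\<Sum>B\<in>Q. real (card B)) = card A"
      using product_partition[OF Q fB] by simp
    ultimately show ?thesis by (simp add: sum_distrib_right[symmetric] algebra_simps)
  qed
  have "(\<Sum>P | partition_on (insert a A) P. ?w P)
      = (\<Sum>(Q, B)\<in>(SIGMA Q:{Q. partition_on A Q}. insert {} Q). ?w (add_to_block a Q B))"
    using sum.reindex_bij_betw[OF bij_betw_add_to_block[OF insert.hyps(2)], of ?w]
    by (simp add: case_prod_unfold)
  also have "\<dots> = (\<Sum>Q | partition_on A Q. \<Sum>B\<in>insert {} Q. ?w (add_to_block a Q B))"
    using finite_elements[OF insert.hyps(1)] finitely_many_partition_on[OF insert.hyps(1)]
    by (subst sum.Sigma) auto
  also have "\<dots> = (\<Sum>Q | partition_on A Q. (x - real (card A)) * ?w Q)"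
    by (rule sum.cong) (use inner in auto)
  finally show ?case
    using insert by (simp add: sum_distrib_left[symmetric] mult.commute)
qed

text \<open>Blocks are nonempty, so the numbers \<open>card S - 1\<close> sum to
  \<open>n - card P\<close>, and the sign distributes over the blocks like the factorials and the
  powers of \<open>x\<close>.\<close>

lemma partition_mu_times_power:
  assumes P: "partition_on {1..n} P"
  shows "partition_mu n P * x ^ card P = (\<Prod>S\<in>P. signed_block_weight x (card S))"
proof -
  have fP: "finite P" and fB: "\<And>B. B \<in> P \<Longrightarrow> finite B" and e: "{} \<notin> P"
    using finite_elements[OF _ P] partition_onD1[OF P] partition_onD3[OF P]
      finite_subset[of _ "{1..n}"] by (simp, blast, simp)
  have pos: "card S \<ge> 1" if "S \<in> P" for S
    using that fB e by (metis One_nat_def Suc_leI card_gt_0_iff)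
  have "(\<Sum>S\<in>P. card S - 1) = (\<Sum>S\<in>P. card S) - card P"
    using pos by (subst sum_subtractf_nat) auto
  then have "(\<Sum>S\<in>P. card S - 1) = n - card P"
    using product_partition[OF P fB] by simp
  then show ?thesis
    by (simp add: partition_mu_def signed_block_weight_def prod.distrib power_sum[symmetric])
qed

text \<open>With \<open>N = Suc n\<close>, the numerator of the binomial coefficient has one factor
  more than this product, namely \<open>m * N - n = (m - 1) * N + 1\<close>, which cancels the
  denominator in \<open>fuss_catalan\<close>.\<close>

lemma prod_eq_fuss_catalan:
  "(\<Prod>i<n. real (m * Suc n) - real i) / fact (Suc n) = fuss_catalan m (Suc n)"
proof (cases "m = 0 \<and> n = 0")
  \<comment> \<open>Here that factor is 0, and the empty product agrees with the value 1 fixed for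
    this case.\<close>
  case True
  then show ?thesis by (simp add: fuss_catalan_def)
next
  case False
  \<comment> \<open>For \<open>m = 0\<close> the factor is \<open>- n\<close> with
    \<open>n > 0\<close>; for \<open>m > 0\<close> it is at least 1.\<close>
  have nz: "(real m - 1) * real (Suc n) + 1 \<noteq> 0"
  proof (cases "m = 0")
    case True
    with False show ?thesis by simp
  next
    case False
    then have "(real m - 1) * real (Suc n) \<ge> 0" by simp
    then show ?thesis by linarith
  qed
  have "real ((m * Suc n) choose (Suc n)) = (\<Prod>i<Suc n. real (m * Suc n) - real i) / fact (Suc n)"
    by (simp only: binomial_gbinomial gbinomial_prod_rev lessThan_atLeast0)
  also have "\<dots> = ((real m - 1) * real (Suc n) + 1) * ((\<Prod>i<n. real (m * Suc n) - real i) / fact (Suc n))"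
    by (simp add: algebra_simps)
  finally show ?thesis using nz False by (simp add: fuss_catalan_def del: of_nat_Suc)
qed

subsection \<open>Weighted Cayley formula\<close>

text \<open>Maps sending each element of \<open>A\<close> to a parent in \<open>R \<union> A\<close> so that iteration always
  leads to \<open>R\<close>; the height function \<open>d\<close> witnesses this.\<close>

definition acyclic_maps :: "'a set \<Rightarrow> 'a set \<Rightarrow> ('a \<Rightarrow> 'a) set" where
  "acyclic_maps R A =
     {p \<in> A \<rightarrow>\<^sub>E R \<union> A. \<exists>d :: 'a \<Rightarrow> nat. \<forall>v\<in>A. p v \<in> A \<longrightarrow> d (p v) < d v}"

lemma finite_acyclic_maps: "finite R \<Longrightarrow> finite A \<Longrightarrow> finite (acyclic_maps R A)"
  by (rule finite_subset[of _ "A \<rightarrow>\<^sub>E R \<union> A"]) (auto simp: acyclic_maps_def intro: finite_PiE)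

text \<open>An element of least height would have a parent in \<open>A\<close> of smaller
  height.\<close>

lemma acyclic_maps_no_roots:
  assumes "A \<noteq> {}"
  shows "acyclic_maps {} A = {}"
proof (rule ccontr)
  assume "acyclic_maps {} A \<noteq> {}"
  then obtain p and d :: "'a \<Rightarrow> nat" where p: "p \<in> A \<rightarrow>\<^sub>E A" and d: "\<And>v. v \<in> A \<Longrightarrow> p v \<in> A \<Longrightarrow> d (p v) < d v"
    by (auto simp: acyclic_maps_def)
  obtain v where v: "v \<in> A" and min: "\<And>u. u \<in> A \<Longrightarrow> d v \<le> d u"
    using assms ex_has_least_nat[of "\<lambda>v. v \<in> A" _ d] by blast
  have "p v \<in> A" using p v by auto
  with d[OF v this] min[OF this] show False by simp
qed

text \<open>\<open>U\<close> is the set of children of the roots. Its elements choose parents in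
  \<open>R\<close> freely; with \<open>U\<close> promoted to root set, the other elements again form
  a forest.\<close>

lemma bij_betw_acyclic_maps_first_layer:
  assumes U: "U \<subseteq> A" and disj: "R \<inter> A = {}"
  shows "bij_betw (\<lambda>(g, q). \<lambda>v\<in>A. if v \<in> U then g v else q v)
    ((U \<rightarrow>\<^sub>E R) \<times> acyclic_maps U (A - U)) {p \<in> acyclic_maps R A. {v \<in> A. p v \<in> R} = U}"
proof (rule bij_betw_byWitness[where f' = "\<lambda>p. (restrict p U, restrict p (A - U))"])
  let ?L = "(U \<rightarrow>\<^sub>E R) \<times> acyclic_maps U (A - U)"
  let ?J = "\<lambda>(g, q). \<lambda>v\<in>A. if v \<in> U then g v else q v"
  let ?M = "{p \<in> acyclic_maps R A. {v \<in> A. p v \<in> R} = U}"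
  show "\<forall>x\<in>?L. (restrict (?J x) U, restrict (?J x) (A - U)) = x"
  proof
    fix x assume "x \<in> ?L"
    then obtain g q where x: "x = (g, q)" and g: "g \<in> U \<rightarrow>\<^sub>E R" and q: "q \<in> acyclic_maps U (A - U)"
      by (elim SigmaE)
    have "restrict (?J (g, q)) U = restrict g U" and "restrict (?J (g, q)) (A - U) = restrict q (A - U)"
      using U by (auto simp: restrict_def fun_eq_iff)
    moreover have "restrict g U = g" and "restrict q (A - U) = q"
      using g q by (auto simp: acyclic_maps_def intro: PiE_restrict)
    ultimately show "(restrict (?J x) U, restrict (?J x) (A - U)) = x"
      unfolding x by (simp only: prod.inject)
  qed
  show "\<forall>p\<in>?M. ?J (restrict p U, restrict p (A - U)) = p"
  proof
    fix p assume "p \<in> ?M"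
    then have "p \<in> A \<rightarrow>\<^sub>E R \<union> A" by (auto simp: acyclic_maps_def)
    then have "p v = undefined" if "v \<notin> A" for v using that by (auto simp: PiE_def extensional_def)
    then show "?J (restrict p U, restrict p (A - U)) = p"
      by (simp add: fun_eq_iff restrict_def)
  qed
  show "?J ` ?L \<subseteq> ?M"
  proof (rule image_subsetI)
    fix x assume "x \<in> ?L"
    then obtain g q where x: "x = (g, q)" and g: "g \<in> U \<rightarrow>\<^sub>E R" and q: "q \<in> acyclic_maps U (A - U)"
      by (elim SigmaE)
    from q obtain d :: "'a \<Rightarrow> nat" where qE: "q \<in> (A - U) \<rightarrow>\<^sub>E U \<union> (A - U)"
      and d: "\<And>v. v \<in> A - U \<Longrightarrow> q v \<in> A - U \<Longrightarrow> d (q v) < d v"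
      by (auto simp: acyclic_maps_def)
    have gv: "g v \<in> R" if "v \<in> U" for v using g that by auto
    have qv: "q v \<in> A" if "v \<in> A - U" for v using PiE_mem[OF qE that] U by auto
    let ?p = "?J (g, q)"
    have pU: "?p v = g v" if "v \<in> U" for v using that U by auto
    have pA: "?p v = q v" if "v \<in> A - U" for v using that by simp
    have "?p v \<in> R \<union> A" if "v \<in> A" for v
      using pU[of v] pA[of v] gv[of v] qv[of v] that by (cases "v \<in> U") simp_all
    then have pE: "?p \<in> A \<rightarrow>\<^sub>E R \<union> A" by (simp add: PiE_def Pi_def)
    \<comment> \<open>The height \<open>d\<close> carries no information on \<open>U\<close>, so
      \<open>U\<close> gets height 0 and the heights outside \<open>U\<close> move up by
      one.\<close>
    have pd: "\<forall>v\<in>A. ?p v \<in> A \<longrightarrow>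
        (if ?p v \<in> U then 0 else Suc (d (?p v))) < (if v \<in> U then 0 else Suc (d v))"
    proof (intro ballI impI)
      fix v assume v: "v \<in> A" "?p v \<in> A"
      have "v \<notin> U" using v(2) pU[of v] gv[of v] disj by force
      moreover from this v have "?p v = q v" "q v \<in> A" using pA[of v] by auto
      ultimately show "(if ?p v \<in> U then 0 else Suc (d (?p v))) < (if v \<in> U then 0 else Suc (d v))"
        using d[of v] v(1) by (simp del: case_prod_conv)
    qed
    have layer: "{v \<in> A. ?p v \<in> R} = U"
    proof (intro equalityI subsetI)
      fix v assume "v \<in> {v \<in> A. ?p v \<in> R}"
      then show "v \<in> U" using pA[of v] qv[of v] disj by force
    next
      fix v assume "v \<in> U"
      then show "v \<in> {v \<in> A. ?p v \<in> R}" using pU[of v] gv[of v] U by force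
    qed
    have "\<exists>d :: 'a \<Rightarrow> nat. \<forall>v\<in>A. ?p v \<in> A \<longrightarrow> d (?p v) < d v"
      by (rule exI[of _ "\<lambda>v. if v \<in> U then 0 else Suc (d v)"]) (rule pd)
    with pE have "?p \<in> acyclic_maps R A"
      unfolding acyclic_maps_def mem_Collect_eq by (rule conjI)
    with layer show "?J x \<in> ?M" unfolding x by (simp only: mem_Collect_eq simp_thms)
  qed
  show "(\<lambda>p. (restrict p U, restrict p (A - U))) ` ?M \<subseteq> ?L"
  proof (rule image_subsetI)
    fix p assume p: "p \<in> ?M"
    then obtain d :: "'a \<Rightarrow> nat" where pE: "p \<in> A \<rightarrow>\<^sub>E R \<union> A"
      and d: "\<And>v. v \<in> A \<Longrightarrow> p v \<in> A \<Longrightarrow> d (p v) < d v" and pU: "{v \<in> A. p v \<in> R} = U"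
      by (auto simp: acyclic_maps_def)
    have "p v \<in> A" if "v \<in> A - U" for v using PiE_mem[OF pE] pU that by auto
    then have "restrict p (A - U) \<in> acyclic_maps U (A - U)"
      using d by (auto simp: acyclic_maps_def intro!: exI[of _ d])
    moreover have "restrict p U \<in> U \<rightarrow>\<^sub>E R" using pU by auto
    ultimately show "(restrict p U, restrict p (A - U)) \<in> ?L" by simp
  qed
qed

text \<open>After sorting by the first layer \<open>U\<close> the weight factors: each element of
  \<open>U\<close> contributes \<open>sum y R\<close> independently, and the forest on
  \<open>A - U\<close> no longer sees \<open>R\<close>.\<close>

lemma sum_acyclic_maps_first_layer:
  fixes y :: "'a \<Rightarrow> real"
  assumes "finite R" "finite A" and disj: "R \<inter> A = {}"
  shows "(\<Sum>p\<in>acyclic_maps R A. \<Prod>v\<in>A. y (p v))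
    = (\<Sum>U\<in>Pow A. sum y R ^ card U * (\<Sum>q\<in>acyclic_maps U (A - U). \<Prod>v\<in>A - U. y (q v)))"
proof -
  have fiber: "(\<Sum>p | p \<in> acyclic_maps R A \<and> {v \<in> A. p v \<in> R} = U. \<Prod>v\<in>A. y (p v))
      = sum y R ^ card U * (\<Sum>q\<in>acyclic_maps U (A - U). \<Prod>v\<in>A - U. y (q v))"
    if U: "U \<subseteq> A" for U
  proof -
    have fU: "finite U" using U assms(2) finite_subset by blast
    have split: "(\<Prod>v\<in>A. y ((\<lambda>v\<in>A. if v \<in> U then g v else q v) v))
        = (\<Prod>v\<in>U. y (g v)) * (\<Prod>v\<in>A - U. y (q v))" for g q
    proof -
      have "(\<Prod>v\<in>A. y ((\<lambda>v\<in>A. if v \<in> U then g v else q v) v))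
          = (\<Prod>v\<in>A - U. y ((\<lambda>v\<in>A. if v \<in> U then g v else q v) v))
            * (\<Prod>v\<in>U. y ((\<lambda>v\<in>A. if v \<in> U then g v else q v) v))"
        by (rule prod.subset_diff[OF U assms(2)])
      also have "\<dots> = (\<Prod>v\<in>A - U. y (q v)) * (\<Prod>v\<in>U. y (g v))"
        using U by (intro arg_cong2[of _ _ _ _ "(*)"] prod.cong) auto
      finally show ?thesis by (simp add: mult.commute)
    qed
    have "(\<Sum>p | p \<in> acyclic_maps R A \<and> {v \<in> A. p v \<in> R} = U. \<Prod>v\<in>A. y (p v))
        = (\<Sum>(g, q)\<in>(U \<rightarrow>\<^sub>E R) \<times> acyclic_maps U (A - U). (\<Prod>v\<in>U. y (g v)) * (\<Prod>v\<in>A - U. y (q v)))"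
      using sum.reindex_bij_betw[OF bij_betw_acyclic_maps_first_layer[OF U disj],
          of "\<lambda>p. \<Prod>v\<in>A. y (p v)"]
      by (simp only: case_prod_unfold split)
    also have "\<dots> = (\<Sum>g\<in>U \<rightarrow>\<^sub>E R. \<Prod>v\<in>U. y (g v)) * (\<Sum>q\<in>acyclic_maps U (A - U). \<Prod>v\<in>A - U. y (q v))"
      by (simp only: sum_product sum.cartesian_product)
    also have "(\<Sum>g\<in>U \<rightarrow>\<^sub>E R. \<Prod>v\<in>U. y (g v)) = sum y R ^ card U"
      using prod_sum_PiE[OF fU, of "\<lambda>_. R" "\<lambda>_. y"] assms(1) by simp
    finally show ?thesis .
  qed
  have "(\<Sum>p\<in>acyclic_maps R A. \<Prod>v\<in>A. y (p v))
    = (\<Sum>U\<in>Pow A. \<Sum>p | p \<in> acyclic_maps R A \<and> {v \<in> A. p v \<in> R} = U. \<Prod>v\<in>A. y (p v))"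
    using assms finite_acyclic_maps by (intro sum.group[symmetric]) auto
  also have "\<dots> = (\<Sum>U\<in>Pow A. sum y R ^ card U * (\<Sum>q\<in>acyclic_maps U (A - U). \<Prod>v\<in>A - U. y (q v)))"
    using fiber by (intro sum.cong) auto
  finally show ?thesis .
qed

section \<open>Binomial sums over subsets\<close>

lemma sum_Pow_binomial:
  fixes a b :: real
  assumes "finite A"
  shows "(\<Sum>U\<in>Pow A. a ^ card U * b ^ card (A - U)) = (a + b) ^ card A"
  using prod_add[OF assms, of "\<lambda>_. a" "\<lambda>_. b"] by simp

text \<open>Mark an element \<open>v\<close> of \<open>U\<close> with weight \<open>y v\<close> and
  exchange the sums: the rest of \<open>U\<close> is an arbitrary subset of \<open>A - {v}\<close>,
  to which the binomial theorem applies, and \<open>v\<close> supplies the separate factor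
  \<open>a\<close>.\<close>

lemma sum_Pow_weighted_binomial:
  fixes a b :: real and y :: "'a \<Rightarrow> real"
  assumes "finite A"
  shows "(\<Sum>U\<in>Pow A. a ^ card U * (sum y U * b ^ card (A - U))) = sum y A * a * (a + b) ^ (card A - 1)"
proof -
  have "(\<Sum>U\<in>Pow A. a ^ card U * (sum y U * b ^ card (A - U)))
      = (\<Sum>U\<in>Pow A. \<Sum>v | v \<in> A \<and> v \<in> U. y v * (a ^ card U * b ^ card (A - U)))"
  proof (rule sum.cong)
    fix U assume "U \<in> Pow A"
    then have "{v. v \<in> A \<and> v \<in> U} = U" by auto
    then show "a ^ card U * (sum y U * b ^ card (A - U))
        = (\<Sum>v | v \<in> A \<and> v \<in> U. y v * (a ^ card U * b ^ card (A - U)))"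
      by (simp add: sum_distrib_right sum_distrib_left algebra_simps)
  qed simp
  also have "\<dots> = (\<Sum>v\<in>A. \<Sum>U | U \<in> Pow A \<and> v \<in> U. y v * (a ^ card U * b ^ card (A - U)))"
    by (rule sum.swap_restrict) (use assms in auto)
  also have "\<dots> = (\<Sum>v\<in>A. y v * (a * (a + b) ^ (card A - 1)))"
  proof (rule sum.cong)
    fix v assume v: "v \<in> A"
    have "bij_betw (insert v) (Pow (A - {v})) {U. U \<in> Pow A \<and> v \<in> U}"
      by (rule bij_betw_byWitness[where f' = "\<lambda>U. U - {v}"]) (use v in auto)
    from sum.reindex_bij_betw[OF this, of "\<lambda>U. y v * (a ^ card U * b ^ card (A - U))"]
    have "(\<Sum>U | U \<in> Pow A \<and> v \<in> U. y v * (a ^ card U * b ^ card (A - U)))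
        = (\<Sum>W\<in>Pow (A - {v}). y v * (a ^ card (insert v W) * b ^ card (A - insert v W)))"
      by simp
    also have "\<dots> = (\<Sum>W\<in>Pow (A - {v}). y v * a * (a ^ card W * b ^ card (A - {v} - W)))"
    proof (rule sum.cong)
      fix W assume W: "W \<in> Pow (A - {v})"
      then have "finite W" "v \<notin> W" using assms finite_subset by auto
      then have "card (insert v W) = Suc (card W)" by simp
      moreover have "A - insert v W = A - {v} - W" by auto
      ultimately show "y v * (a ^ card (insert v W) * b ^ card (A - insert v W))
          = y v * a * (a ^ card W * b ^ card (A - {v} - W))"
        by simp
    qed simp
    also have "\<dots> = y v * (a * (a + b) ^ (card A - 1))"
      using sum_Pow_binomial[of "A - {v}" a b] assms v
      by (simp add: sum_distrib_left[symmetric] mult.assoc)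
    finally show "(\<Sum>U | U \<in> Pow A \<and> v \<in> U. y v * (a ^ card U * b ^ card (A - U))) = \<dots>" .
  qed simp
  finally show ?thesis by (simp only: sum_distrib_right mult.assoc)
qed

lemma sum_acyclic_maps:
  fixes y :: "'a \<Rightarrow> real"
  assumes "finite R" "finite A" "R \<inter> A = {}" "A \<noteq> {}" and nonneg: "\<And>v. v \<in> A \<Longrightarrow> y v \<ge> 0"
  shows "(\<Sum>p\<in>acyclic_maps R A. \<Prod>v\<in>A. y (p v)) = sum y R * (sum y R + sum y A) ^ (card A - 1)"
  using assms
proof (induction "card A" arbitrary: R A rule: less_induct)
  case less
  \<comment> \<open>Split by the set \<open>U\<close> of children of \<open>R\<close>; what remains is a forest on \<open>A - U\<close> rooted in \<open>U\<close>.\<close>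
  let ?r = "sum y R" and ?a = "sum y A"
  let ?S = "\<lambda>R A. \<Sum>p\<in>acyclic_maps R A. \<Prod>v\<in>A. y (p v)"
  have layer: "?S U (A - U) = (if U = A then 1 else sum y U * ?a ^ (card (A - U) - 1))"
    if U: "U \<subseteq> A" for U
  proof -
    \<comment> \<open>For \<open>U = A\<close> only the map on the empty set is left; for
      \<open>U = {}\<close> there are no roots and \<open>sum y {} = 0\<close>; otherwise induction
      applies, with total weight \<open>sum y U + sum y (A - U) = ?a\<close>.\<close>
    consider "U = A" | "U = {}" "U \<noteq> A" | "U \<noteq> {}" "U \<noteq> A" by blast
    then show ?thesis
    proof cases
      case 1
      have "acyclic_maps A {} = {\<lambda>_. undefined}" by (auto simp: acyclic_maps_def)
      with 1 show ?thesis by simp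
    next
      case 2
      then show ?thesis using acyclic_maps_no_roots[of A] by simp
    next
      case 3
      have "card (A - U) < card A"
        using 3 U less.prems(2) by (intro psubset_card_mono) auto
      moreover have "sum y U + sum y (A - U) = ?a"
        using sum.subset_diff[OF U less.prems(2), of y] by simp
      ultimately show ?thesis
        using less.hyps[of "A - U" U] 3 U less.prems finite_subset[OF U] by auto
    qed
  qed
  have S: "?S R A = (\<Sum>U\<in>Pow A. ?r ^ card U * (if U = A then 1 else sum y U * ?a ^ (card (A - U) - 1)))"
    using less.prems(1-3) layer by (simp add: sum_acyclic_maps_first_layer)
  have A: "card A > 0" using less.prems by (simp add: card_gt_0_iff)
  show ?case
  \<comment> \<open>The main case divides by \<open>?a\<close>. If \<open>?a = 0\<close>,
    nonnegativity makes all weights on \<open>A\<close> vanish, and only \<open>U = A\<close>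
    contributes.\<close>
  proof (cases "?a = 0")
    case True
    then have "\<forall>v\<in>A. y v = 0"
      using less.prems by (simp add: sum_nonneg_eq_0_iff)
    then have y0: "sum y U = 0" if "U \<subseteq> A" for U using that by (intro sum.neutral) auto
    have "?S R A = (\<Sum>U\<in>Pow A. if U = A then ?r ^ card A else 0)"
      unfolding S by (rule sum.cong) (auto simp: y0)
    also have "\<dots> = ?r ^ card A" using less.prems(2) by simp
    also have "\<dots> = ?r * (?r + ?a) ^ (card A - 1)"
      using A True by (cases "card A") simp_all
    finally show ?thesis .
  next
    case False
    \<comment> \<open>Multiplying by \<open>?a\<close> raises the exponent to
      \<open>card (A - U)\<close> and gives the exceptional summand \<open>U = A\<close> the same
      shape, since \<open>sum y A = ?a\<close>.\<close>
    have "?a * ?S R A = (\<Sum>U\<in>Pow A. ?r ^ card U * (sum y U * ?a ^ card (A - U)))"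
      unfolding S sum_distrib_left
    proof (rule sum.cong)
      fix U assume U: "U \<in> Pow A"
      show "?a * (?r ^ card U * (if U = A then 1 else sum y U * ?a ^ (card (A - U) - 1)))
          = ?r ^ card U * (sum y U * ?a ^ card (A - U))"
      proof (cases "U = A")
        case False
        then have "card (A - U) > 0" using U less.prems(2) by (auto simp: card_gt_0_iff)
        then show ?thesis using False by (cases "card (A - U)") simp_all
      qed simp
    qed simp
    also have "\<dots> = ?a * (?r * (?r + ?a) ^ (card A - 1))"
      using sum_Pow_weighted_binomial[OF less.prems(2), of ?r y ?a] by simp
    finally show ?thesis using False by simp
  qed
qed

subsection \<open>Spanning trees and parent maps\<close>

definition well_formed :: "('v, 'e) multigraph \<Rightarrow> bool" where
  "well_formed H \<longleftrightarrow> (\<forall>e\<in>edges H. \<exists>u\<in>vertices H. \<exists>v\<in>vertices H. ends H e = {u, v})"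

text \<open>Trees rooted at \<open>r\<close>, with the choice of the edge from each vertex to its parent.\<close>

definition parent_edges :: "('v, 'e) multigraph \<Rightarrow> 'v \<Rightarrow> ('v \<Rightarrow> 'e) set" where
  "parent_edges H r =
     {f \<in> (vertices H - {r}) \<rightarrow>\<^sub>E edges H.
        \<exists>p. \<exists>d :: 'v \<Rightarrow> nat. \<forall>v\<in>vertices H - {r}. ends H (f v) = {v, p v} \<and> d (p v) < d v}"

section \<open>Paths and cycles from connectivity\<close>

lemma mg_adj_path:
  assumes "(u, v) \<in> (mg_adj H)\<^sup>*" and wf: "well_formed H" and u: "u \<in> vertices H"
  shows "\<exists>vs es. vs \<noteq> [] \<and> hd vs = u \<and> last vs = v \<and> length vs = Suc (length es) \<and>
    distinct vs \<and> set vs \<subseteq> vertices H \<and> set es \<subseteq> edges H \<and>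
    (\<forall>i<length es. ends H (es ! i) = {vs ! i, vs ! Suc i})"
  using assms(1)
proof (induction rule: rtrancl_induct)
  case base
  show ?case by (rule exI[of _ "[u]"], rule exI[of _ "[]"]) (use u in simp)
next
  case (step y z)
  then obtain vs es where vs: "vs \<noteq> []" "hd vs = u" "last vs = y" "length vs = Suc (length es)"
    "distinct vs" "set vs \<subseteq> vertices H" "set es \<subseteq> edges H"
    and es: "\<And>i. i < length es \<Longrightarrow> ends H (es ! i) = {vs ! i, vs ! Suc i}"
    by blast
  from step.hyps(2) obtain e where e: "e \<in> edges H" "ends H e = {y, z}"
    by (auto simp: mg_adj_def)
  have z: "z \<in> vertices H"
  proof -
    have "ends H e \<subseteq> vertices H" using wf e(1) by (fastforce simp: well_formed_def)
    then show ?thesis using e(2) by simp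
  qed
  show ?case
  \<comment> \<open>If the walk returns to a vertex of the path, the path is cut back to it;
    otherwise the new edge is appended.\<close>
  proof (cases "z \<in> set vs")
    case True
    then obtain k where k: "k < length vs" "vs ! k = z" by (auto simp: in_set_conv_nth)
    have "last (take (Suc k) vs) = z" using k by (simp add: take_Suc_conv_app_nth)
    moreover have "hd (take (Suc k) vs) = u" using vs by simp
    moreover have "set (take (Suc k) vs) \<subseteq> vertices H" "set (take k es) \<subseteq> edges H"
      using vs set_take_subset by fast+
    ultimately show ?thesis
      using vs k es by (intro exI[of _ "take (Suc k) vs"] exI[of _ "take k es"]) simp
  next
    case False
    have "ends H ((es @ [e]) ! i) = {(vs @ [z]) ! i, (vs @ [z]) ! Suc i}"
      if "i < length (es @ [e])" for i
    proof (cases "i < length es")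
      case True
      then show ?thesis using es vs(4) by (simp add: nth_append)
    next
      case False
      then have "i = length es" using that by simp
      moreover have "vs ! length es = y" using vs by (simp add: last_conv_nth)
      ultimately show ?thesis using e(2) vs(4) by (simp add: nth_append)
    qed
    then show ?thesis
      using vs e z False by (intro exI[of _ "vs @ [z]"] exI[of _ "es @ [e]"]) simp
  qed
qed

text \<open>The path in \<open>T\<close> from \<open>u\<close> to \<open>v\<close> is closed up by
  \<open>e\<close>. For \<open>u = v\<close> the path is trivial and the cycle is the loop
  \<open>e\<close>.\<close>

lemma path_and_edge_yield_cycle:
  assumes wf: "well_formed H" and T: "T \<subseteq> edges H" and e: "e \<in> edges H" "e \<notin> T"
    and uv: "ends H e = {u, v}" "u \<in> vertices H" "(u, v) \<in> (mg_adj (H\<lparr>edges := T\<rparr>))\<^sup>*"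
  shows "\<exists>vs es. mg_cycle H vs es"
proof -
  have "well_formed (H\<lparr>edges := T\<rparr>)" using wf T by (auto simp: well_formed_def)
  from mg_adj_path[OF uv(3) this] uv(2) obtain vs es
    where vs: "vs \<noteq> []" "hd vs = u" "last vs = v" "length vs = Suc (length es)"
    "distinct vs" "set vs \<subseteq> vertices H" "set es \<subseteq> T"
    and es: "\<And>i. i < length es \<Longrightarrow> ends H (es ! i) = {vs ! i, vs ! Suc i}"
    by auto
  \<comment> \<open>As the vertices of the path are distinct, \<open>vs ! i\<close> lies on no edge
    with index \<open>j > i\<close>.\<close>
  have neq: "es ! i \<noteq> es ! j" if "i < j" "j < length es" for i j
  proof
    assume "es ! i = es ! j"
    then have "vs ! i \<in> {vs ! j, vs ! Suc j}"
      using es[of i] es[of j] that by (metis insertI1 less_trans)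
    moreover have "vs ! i \<noteq> vs ! j" "vs ! i \<noteq> vs ! Suc j"
      using vs(4,5) that by (simp_all add: nth_eq_iff_index_eq)
    ultimately show False by blast
  qed
  have "distinct es"
    unfolding distinct_conv_nth using neq by (metis nat_neq_iff)
  moreover have "ends H ((es @ [e]) ! i) = {vs ! i, vs ! (Suc i mod length (es @ [e]))}"
    if "i < length (es @ [e])" for i
  proof (cases "i < length es")
    case True
    then show ?thesis using es by (simp add: nth_append)
  next
    case False
    then have i: "i = length es" using that by simp
    moreover have "vs ! length es = v" "vs ! 0 = u"
      using vs by (simp_all add: last_conv_nth hd_conv_nth)
    ultimately show ?thesis using uv(1) by (simp add: insert_commute)
  qed
  ultimately have "mg_cycle H vs (es @ [e])"
    using vs T e by (auto simp: mg_cycle_def)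
  then show ?thesis by blast
qed

text \<open>At a vertex of greatest height on a cycle both cycle edges lead down, so both are the
  parent edge of this vertex and one edge occurs twice.\<close>

lemma parent_edges_acyclic:
  assumes f: "\<And>v. v \<in> A \<Longrightarrow> ends H (f v) = {v, p v} \<and> d (p v) < (d v :: nat)"
  shows "\<not> mg_cycle (H\<lparr>edges := f ` A\<rparr>) vs es"
proof
  assume c: "mg_cycle (H\<lparr>edges := f ` A\<rparr>) vs es"
  let ?k = "length es"
  have k: "?k > 0" and len: "length vs = ?k" and des: "distinct es" and es: "set es \<subseteq> f ` A"
    and en: "\<And>i. i < ?k \<Longrightarrow> ends H (es ! i) = {vs ! i, vs ! (Suc i mod ?k)}"
    using c by (auto simp: mg_cycle_def)
  let ?m = "Max ((\<lambda>i. d (vs ! i)) ` {..<?k})"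
  have "?m \<in> (\<lambda>i. d (vs ! i)) ` {..<?k}" using k by (intro Max_in) auto
  then obtain i where i: "i < ?k" and im: "d (vs ! i) = ?m" by auto
  have max: "d (vs ! j) \<le> d (vs ! i)" if "j < ?k" for j
    unfolding im using that by (intro Max_ge) auto
  let ?v = "vs ! i"
  \<comment> \<open>Were this the parent edge of its other end, \<open>?v\<close> would be lower
    than that end, against maximality. The edge is no loop, hence
    \<open>j \<noteq> i\<close>.\<close>
  have only: "es ! l = f ?v \<and> j \<noteq> i" if l: "l < ?k" "j < ?k" "ends H (es ! l) = {?v, vs ! j}" for l j
  proof -
    have "es ! l \<in> f ` A" using es l(1) by (meson nth_mem subsetD)
    then obtain u where u: "u \<in> A" "es ! l = f u" by blast
    then have *: "{u, p u} = {?v, vs ! j}" "d (p u) < d u" using f[OF u(1)] l(3) by auto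
    then have "u = ?v" using max[OF l(2)] by (metis doubleton_eq_iff not_le)
    moreover from * have "?v \<noteq> vs ! j" by (metis doubleton_eq_iff less_irrefl)
    ultimately show ?thesis using u by auto
  qed
  \<comment> \<open>The cyclic predecessor of \<open>i\<close>. On a cycle of length 1 it equals
    \<open>i\<close>, which the second half of \<open>only\<close> excludes.\<close>
  define j where "j = (if i = 0 then ?k - 1 else i - 1)"
  have j: "j < ?k" "Suc j mod ?k = i" using i k by (auto simp: j_def)
  have s: "Suc i mod ?k < ?k" using k by simp
  have "es ! i = f ?v" using only[OF i s] en[OF i] by blast
  moreover have "es ! j = f ?v \<and> j \<noteq> i"
    using only[OF j(1) j(1)] en[OF j(1)] j(2) by (simp add: insert_commute)
  ultimately show False using des i j(1) by (metis nth_eq_iff_index_eq)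
qed

text \<open>Following parents lowers \<open>d\<close> and can stop only at \<open>r\<close>, so
  every vertex is connected to \<open>r\<close>; the heights exclude cycles.\<close>

lemma parent_edges_spanning_tree:
  assumes f: "f \<in> parent_edges H r" and r: "r \<in> vertices H" and wf: "well_formed H"
  shows "f ` (vertices H - {r}) \<in> spanning_trees H"
proof -
  let ?A = "vertices H - {r}"
  let ?H = "H\<lparr>edges := f ` ?A\<rparr>"
  from f obtain p and d :: "'a \<Rightarrow> nat" where fE: "f \<in> ?A \<rightarrow>\<^sub>E edges H"
    and fp: "\<And>v. v \<in> ?A \<Longrightarrow> ends H (f v) = {v, p v} \<and> d (p v) < d v"
    unfolding parent_edges_def by blast
  have sub: "f ` ?A \<subseteq> edges H" using fE by auto
  have pV: "p v \<in> vertices H" if "v \<in> ?A" for v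
  proof -
    have "ends H (f v) \<subseteq> vertices H"
      using wf PiE_mem[OF fE that] by (fastforce simp: well_formed_def)
    then show ?thesis using fp[OF that] by simp
  qed
  have to_root: "(v, r) \<in> (mg_adj ?H)\<^sup>*" if "v \<in> vertices H" for v
    using that
  proof (induction "d v" arbitrary: v rule: less_induct)
    case less
    show ?case
    proof (cases "v = r")
      case False
      then have v: "v \<in> ?A" using less.prems by simp
      then have "(v, p v) \<in> mg_adj ?H" using fp[OF v] by (auto simp: mg_adj_def)
      moreover have "(p v, r) \<in> (mg_adj ?H)\<^sup>*" using less.hyps fp[OF v] pV[OF v] by blast
      ultimately show ?thesis by (rule converse_rtrancl_into_rtrancl)
    qed simp
  qed
  have "sym (mg_adj ?H)" by (auto simp: sym_def mg_adj_def insert_commute)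
  then have "sym ((mg_adj ?H)\<^sup>*)" by (rule sym_rtrancl)
  then have "mg_connected ?H"
    using to_root r unfolding mg_connected_def by (auto dest: symD intro: rtrancl_trans)
  then show ?thesis
    using parent_edges_acyclic[of ?A H f p d] fp sub by (auto simp: spanning_trees_def mg_tree_def)
qed

text \<open>Each vertex other than \<open>r\<close> takes an edge of \<open>T\<close> to a vertex at
  smaller distance from \<open>r\<close> within \<open>T\<close>. These edges already connect the
  graph, so any further edge of \<open>T\<close> would close a cycle.\<close>

lemma spanning_tree_parent_edges:
  assumes T: "T \<in> spanning_trees H" and r: "r \<in> vertices H" and wf: "well_formed H"
  shows "\<exists>f\<in>parent_edges H r. f ` (vertices H - {r}) = T"
proof -
  let ?A = "vertices H - {r}"
  let ?H = "H\<lparr>edges := T\<rparr>"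
  have TE: "T \<subseteq> edges H" and con: "mg_connected ?H" and nocycle: "\<nexists>vs es. mg_cycle ?H vs es"
    using T by (auto simp: spanning_trees_def mg_tree_def)
  have wfT: "well_formed ?H" using wf TE by (auto simp: well_formed_def)
  define d where "d v = (LEAST k. (v, r) \<in> mg_adj ?H ^^ k)" for v
  have step: "\<exists>e\<in>T. \<exists>u. ends H e = {v, u} \<and> d u < d v" if v: "v \<in> ?A" for v
  proof -
    have "(v, r) \<in> (mg_adj ?H)\<^sup>*" using con v r by (auto simp: mg_connected_def)
    then have "\<exists>k. (v, r) \<in> mg_adj ?H ^^ k" by (simp add: rtrancl_power)
    then have dv: "(v, r) \<in> mg_adj ?H ^^ d v" unfolding d_def by (rule LeastI_ex)
    moreover have "d v \<noteq> 0" using dv v by (cases "d v") auto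
    ultimately obtain k where k: "d v = Suc k" "(v, r) \<in> mg_adj ?H ^^ Suc k"
      by (metis not0_implies_Suc)
    then obtain u where u: "(v, u) \<in> mg_adj ?H" "(u, r) \<in> mg_adj ?H ^^ k"
      by (meson relpow_Suc_D2)
    have "d u \<le> k" unfolding d_def using u(2) by (rule Least_le)
    then show ?thesis using u(1) k(1) by (force simp: mg_adj_def less_Suc_eq_le)
  qed
  then obtain g where g: "\<And>v. v \<in> ?A \<Longrightarrow> g v \<in> T \<and> (\<exists>u. ends H (g v) = {v, u} \<and> d u < d v)"
    by metis
  then obtain p where p: "\<And>v. v \<in> ?A \<Longrightarrow> ends H (g v) = {v, p v} \<and> d (p v) < d v"
    by metis
  have f: "restrict g ?A \<in> parent_edges H r"
  proof -
    have "restrict g ?A \<in> ?A \<rightarrow>\<^sub>E edges H" using g TE by (auto simp: restrict_PiE_iff)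
    moreover have "\<forall>v\<in>?A. ends H (restrict g ?A v) = {v, p v} \<and> d (p v) < d v"
      using p by simp
    ultimately show ?thesis unfolding parent_edges_def by blast
  qed
  from parent_edges_spanning_tree[OF this r wf]
  have con': "mg_connected (H\<lparr>edges := g ` ?A\<rparr>)"
    by (simp add: spanning_trees_def mg_tree_def)
  have gT: "g ` ?A \<subseteq> T" using g by blast
  have "T \<subseteq> g ` ?A"
  proof
    fix e assume e: "e \<in> T"
    then obtain u v where uv: "ends H e = {u, v}" "u \<in> vertices H" "v \<in> vertices H"
      using wf TE unfolding well_formed_def by blast
    show "e \<in> g ` ?A"
    proof (rule ccontr)
      assume "e \<notin> g ` ?A"
      moreover have "(u, v) \<in> (mg_adj (H\<lparr>edges := g ` ?A\<rparr>))\<^sup>*"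
        using con' uv(2,3) by (simp add: mg_connected_def)
      ultimately have "\<exists>vs es. mg_cycle ?H vs es"
        using path_and_edge_yield_cycle[OF wfT, of "g ` ?A" e u v] gT e uv by simp
      with nocycle show False by blast
    qed
  qed
  with gT have "restrict g ?A ` ?A = T" by simp
  from this f show ?thesis by (rule bexI)
qed

text \<open>Induction on the height for \<open>f\<close>. If \<open>f v = g w\<close> with
  \<open>w \<noteq> v\<close>, then \<open>w\<close> is the parent of \<open>v\<close>, so
  \<open>f w = g w = f v\<close> by induction, and \<open>v\<close> and \<open>w\<close> would each
  be the parent of the other.\<close>

lemma parent_edges_image_inj:
  "inj_on (\<lambda>f. f ` (vertices H - {r})) (parent_edges H r)"
proof (rule inj_onI)
  let ?A = "vertices H - {r}"
  fix f g assume f: "f \<in> parent_edges H r" and g: "g \<in> parent_edges H r" and eq: "f ` ?A = g ` ?A"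
  from f obtain p and d :: "'a \<Rightarrow> nat" where fE: "f \<in> ?A \<rightarrow>\<^sub>E edges H"
    and fp: "\<And>v. v \<in> ?A \<Longrightarrow> ends H (f v) = {v, p v} \<and> d (p v) < d v"
    unfolding parent_edges_def by blast
  from g obtain q where gE: "g \<in> ?A \<rightarrow>\<^sub>E edges H"
    and gq: "\<And>v. v \<in> ?A \<Longrightarrow> ends H (g v) = {v, q v}"
    unfolding parent_edges_def by blast
  have "f v = g v" if "v \<in> ?A" for v
    using that
  proof (induction "d v" arbitrary: v rule: less_induct)
    case less
    have "f v \<in> g ` ?A" using eq less.prems by blast
    then obtain w where w: "w \<in> ?A" "f v = g w" by blast
    show ?case
    proof (cases "w = v")
      case False
      have "{v, p v} = {w, q w}" using fp[OF less.prems] gq[OF w(1)] w(2) by simp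
      then have pv: "p v = w" using False by (metis doubleton_eq_iff)
      then have "f w = f v" using less.hyps[OF _ w(1)] fp[OF less.prems] w(2) by simp
      then have "{w, p w} = {v, w}" using fp[OF w(1)] fp[OF less.prems] pv by simp
      then have "p w = v" using False by (metis doubleton_eq_iff)
      then have False using fp[OF w(1)] fp[OF less.prems] pv by simp
      then show ?thesis ..
    qed (use w in simp)
  qed
  then show "f = g" using fE gE by (rule_tac PiE_ext)
qed

text \<open>The endpoints of the chosen edges determine the parent map, so the choices can be sorted
  by it; for a fixed parent map they are independent at the different vertices.\<close>

lemma card_parent_edges:
  assumes "finite (vertices H)" "finite (edges H)" and r: "r \<in> vertices H" and wf: "well_formed H"
  shows "card (parent_edges H r)
    = (\<Sum>p\<in>acyclic_maps {r} (vertices H - {r}). \<Prod>v\<in>vertices H - {r}. card {e \<in> edges H. ends H e = {v, p v}})"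
proof -
  let ?A = "vertices H - {r}"
  let ?F = "\<lambda>p. \<Pi>\<^sub>E v\<in>?A. {e \<in> edges H. ends H e = {v, p v}}"
  have "parent_edges H r \<subseteq> (\<Union>p\<in>acyclic_maps {r} ?A. ?F p)"
  proof
    fix f assume "f \<in> parent_edges H r"
    then obtain p and d :: "'a \<Rightarrow> nat" where fE: "f \<in> ?A \<rightarrow>\<^sub>E edges H"
      and fp: "\<And>v. v \<in> ?A \<Longrightarrow> ends H (f v) = {v, p v} \<and> d (p v) < d v"
      unfolding parent_edges_def by blast
    have pV: "p v \<in> vertices H" if "v \<in> ?A" for v
    proof -
      have "ends H (f v) \<subseteq> vertices H"
        using wf PiE_mem[OF fE that] by (fastforce simp: well_formed_def)
      then show ?thesis using fp[OF that] by simp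
    qed
    have "restrict p ?A \<in> acyclic_maps {r} ?A"
      unfolding acyclic_maps_def using pV fp r by (auto intro!: exI[of _ d])
    moreover have "f \<in> ?F (restrict p ?A)"
      using fE fp by (simp add: PiE_iff)
    ultimately show "f \<in> (\<Union>p\<in>acyclic_maps {r} ?A. ?F p)" by blast
  qed
  moreover have "?F p \<subseteq> parent_edges H r" if p: "p \<in> acyclic_maps {r} ?A" for p
  proof
    fix f assume f: "f \<in> ?F p"
    from p obtain d :: "'a \<Rightarrow> nat" where pE: "p \<in> ?A \<rightarrow>\<^sub>E {r} \<union> ?A"
      and d: "\<And>v. v \<in> ?A \<Longrightarrow> p v \<in> ?A \<Longrightarrow> d (p v) < d v"
      unfolding acyclic_maps_def by blast
    \<comment> \<open>Acyclic maps compare heights only inside \<open>?A\<close>, parent edges also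
      at \<open>r\<close>; so \<open>r\<close> gets height 0 and all others move up by one.\<close>
    define d' where "d' v = (if v = r then 0 else Suc (d v))" for v
    have "d' (p v) < d' v" if "v \<in> ?A" for v
      using d[OF that] PiE_mem[OF pE that] that by (auto simp: d'_def)
    moreover have "f \<in> ?A \<rightarrow>\<^sub>E edges H" "\<And>v. v \<in> ?A \<Longrightarrow> ends H (f v) = {v, p v}"
      using f by (simp_all add: PiE_iff)
    ultimately show "f \<in> parent_edges H r" unfolding parent_edges_def by blast
  qed
  ultimately have eq: "parent_edges H r = (\<Union>p\<in>acyclic_maps {r} ?A. ?F p)" by blast
  have disj: "?F p \<inter> ?F q = {}"
    if p: "p \<in> acyclic_maps {r} ?A" and q: "q \<in> acyclic_maps {r} ?A" and "p \<noteq> q" for p q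
  proof (rule ccontr)
    assume "?F p \<inter> ?F q \<noteq> {}"
    then obtain f where f: "f \<in> ?F p" "f \<in> ?F q" by blast
    have eqpq: "{v, p v} = {v, q v}" if "v \<in> ?A" for v
      using PiE_mem[OF f(1) that] PiE_mem[OF f(2) that] by auto
    have "p v = q v" if "v \<in> ?A" for v
      using eqpq[OF that] by (auto simp: doubleton_eq_iff)
    then have "p = q" using p q by (intro PiE_ext[of p ?A _ q]) (auto simp: acyclic_maps_def)
    with \<open>p \<noteq> q\<close> show False ..
  qed
  have "card (parent_edges H r) = (\<Sum>p\<in>acyclic_maps {r} ?A. card (?F p))"
    unfolding eq by (rule card_UN_disjoint)
      (use assms disj in \<open>auto intro!: finite_acyclic_maps finite_PiE\<close>)
  then show ?thesis using assms(1) by (simp add: card_PiE)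
qed

lemma card_spanning_trees:
  assumes "finite (vertices H)" "finite (edges H)" and r: "r \<in> vertices H" and wf: "well_formed H"
  shows "card (spanning_trees H)
    = (\<Sum>p\<in>acyclic_maps {r} (vertices H - {r}). \<Prod>v\<in>vertices H - {r}. card {e \<in> edges H. ends H e = {v, p v}})"
proof -
  have "spanning_trees H = (\<lambda>f. f ` (vertices H - {r})) ` parent_edges H r"
    using parent_edges_spanning_tree[OF _ r wf] spanning_tree_parent_edges[OF _ r wf] by blast
  then show ?thesis
    using card_image[OF parent_edges_image_inj[of H r]] card_parent_edges[OF assms] by simp
qed

subsection \<open>The contracted graph\<close>

context
  fixes m n :: nat and P :: "nat set set"
  assumes P: "partition_on {1..n} P"
begin

lemma block_subset: "B \<in> P \<Longrightarrow> B \<subseteq> {1..n}"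
  using P by (auto simp: partition_on_def)

lemma merged_vertex_block: "B \<in> P \<Longrightarrow> i \<in> B \<Longrightarrow> merged_vertex P i = B"
  using merged_vertex_in_block partition_onD2[OF P] by metis

lemma merged_vertex_zero: "merged_vertex P 0 = {0}"
  using block_subset by (intro merged_vertex_not_in_block) force

lemma merged_vertex_eq_block_iff:
  assumes "i \<in> {1..n}"
  shows "merged_vertex P i \<in> P" and "B \<in> P \<Longrightarrow> merged_vertex P i = B \<longleftrightarrow> i \<in> B"
proof -
  obtain C where "C \<in> P" "i \<in> C" using assms partition_onD1[OF P] by blast
  then have C: "C \<in> P" "i \<in> C" "merged_vertex P i = C" using merged_vertex_block by auto
  show "merged_vertex P i \<in> P" using C by simp
  show "merged_vertex P i = B \<longleftrightarrow> i \<in> B" if "B \<in> P"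
    using C merged_vertex_block[OF that] by auto
qed

lemma zero_not_block: "{0} \<notin> P"
  using block_subset by force

abbreviation (input) contraction :: "(nat set, nat \<times> nat \<times> nat) multigraph" where
  "contraction \<equiv> contract_blocks (Gamma_graph m n) P"

lemma vertices_contraction: "vertices contraction = insert {0} P"
proof -
  have "merged_vertex P ` {1..n} = P"
  proof
    show "merged_vertex P ` {1..n} \<subseteq> P" using merged_vertex_eq_block_iff(1) by blast
    show "P \<subseteq> merged_vertex P ` {1..n}"
    proof
      fix B assume B: "B \<in> P"
      then obtain i where "i \<in> B" using partition_onD3[OF P] by (metis all_not_in_conv)
      then show "B \<in> merged_vertex P ` {1..n}"
        using B merged_vertex_block block_subset by blast
    qed
  qed
  moreover have "{0..n} = insert 0 {1..n}" by auto
  ultimately show ?thesis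
    by (simp add: contract_blocks_def Gamma_graph_def merged_vertex_zero)
qed

lemma ends_contraction:
  "ends contraction (i, j, k) = {merged_vertex P i, merged_vertex P j}"
  by (simp add: contract_blocks_def Gamma_graph_def)

lemma edges_contraction:
  "edges contraction = {(i, j, k). 1 \<le> i \<and> i < j \<and> j \<le> n \<and> k < m} \<union> {(0, i, 0) |i. i \<in> {1..n}}"
  by (simp add: contract_blocks_def Gamma_graph_def)

lemma finite_edges_contraction: "finite (edges contraction)"
  \<comment> \<open>The last range is \<open>{0..m}\<close> because the edges at 0 have third entry
    0 even when \<open>m = 0\<close>.\<close>
  by (rule finite_subset[of _ "{0..n} \<times> {0..n} \<times> {0..m}"]) (auto simp: edges_contraction)

lemma well_formed_contraction: "well_formed contraction"
  unfolding well_formed_def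
proof
  fix e assume e: "e \<in> edges contraction"
  obtain i j k where [simp]: "e = (i, j, k)" by (metis surj_pair)
  have "merged_vertex P l \<in> vertices contraction" if "l \<le> n" for l
    using that by (simp add: contract_blocks_def Gamma_graph_def)
  moreover have "i \<le> n" "j \<le> n" using e by (auto simp: edges_contraction)
  ultimately show "\<exists>u\<in>vertices contraction. \<exists>v\<in>vertices contraction. ends contraction e = {u, v}"
    by (auto simp: ends_contraction)
qed

text \<open>Each \<open>i\<close> in \<open>B\<close> brings one edge to 0. An edge between positive
  vertices has blocks at both ends, and \<open>{0}\<close> is no block.\<close>

lemma card_edges_to_zero:
  assumes B: "B \<in> P"
  shows "card {e \<in> edges contraction. ends contraction e = {B, {0}}} = card B"
proof -
  have "{e \<in> edges contraction. ends contraction e = {B, {0}}} = (\<lambda>i. (0, i, 0)) ` B"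
  proof (intro equalityI subsetI)
    fix e assume e: "e \<in> {e \<in> edges contraction. ends contraction e = {B, {0}}}"
    obtain i j k where ijk: "e = (i, j, k)" by (metis surj_pair)
    have en: "{merged_vertex P i, merged_vertex P j} = {B, {0}}"
      using e by (simp add: ijk ends_contraction)
    have "i = 0"
    proof (rule ccontr)
      assume "i \<noteq> 0"
      then have "i \<in> {1..n}" "j \<in> {1..n}" using e by (auto simp: ijk edges_contraction)
      then have "{B, {0}} \<subseteq> P" using merged_vertex_eq_block_iff(1) by (auto simp: en[symmetric])
      then show False using zero_not_block by simp
    qed
    then have j: "j \<in> {1..n}" and "k = 0" using e by (auto simp: ijk edges_contraction)
    have "merged_vertex P j = B"
    proof -
      have "merged_vertex P j \<in> {B, {0}}" unfolding en[symmetric] by simp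
      moreover have "merged_vertex P j \<noteq> {0}"
        using zero_not_block merged_vertex_eq_block_iff(1)[OF j] by metis
      ultimately show ?thesis by blast
    qed
    then have "j \<in> B" by (rule merged_vertex_eq_block_iff(2)[OF j B, THEN iffD1])
    then show "e \<in> (\<lambda>i. (0, i, 0)) ` B"
      unfolding ijk \<open>i = 0\<close> \<open>k = 0\<close> by (rule imageI)
  next
    fix e :: "nat \<times> nat \<times> nat" assume "e \<in> (\<lambda>i. (0, i, 0)) ` B"
    then obtain i where i: "i \<in> B" "e = (0, i, 0)" by blast
    have "e \<in> edges contraction" using i block_subset[OF B] by (auto simp: edges_contraction)
    moreover have "ends contraction e = {B, {0}}"
      using i(1) unfolding i(2) ends_contraction merged_vertex_zero by (simp add: merged_vertex_block[OF B] insert_commute)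
    ultimately show "e \<in> {e \<in> edges contraction. ends contraction e = {B, {0}}}" by simp
  qed
  then show ?thesis by (simp add: card_image inj_on_def)
qed

text \<open>Edges are stored with the smaller endpoint first. Reading one from \<open>B\<close> to
  \<open>C\<close> gives a triple \<open>(b, k, c)\<close>, uniquely since the blocks are disjoint;
  sorting the endpoints goes back.\<close>

lemma card_edges_between_blocks:
  assumes B: "B \<in> P" and C: "C \<in> P" and "B \<noteq> C"
  shows "card {e \<in> edges contraction. ends contraction e = {B, C}} = card B * (m * card C)"
proof -
  let ?E = "{e \<in> edges contraction. ends contraction e = {B, C}}"
  have disj: "B \<inter> C = {}" using partition_onD2[OF P] assms by (auto dest: disjointD)
  have "bij_betw (\<lambda>(b, k, c). (min b c, max b c, k)) (B \<times> {..<m} \<times> C) ?E"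
  proof (rule bij_betw_byWitness[where f' = "\<lambda>(i, j, k). if i \<in> B then (i, k, j) else (j, k, i)"])
    show "\<forall>x\<in>B \<times> {..<m} \<times> C. (\<lambda>(i, j, k). if i \<in> B then (i, k, j) else (j, k, i))
        ((\<lambda>(b, k, c). (min b c, max b c, k)) x) = x"
      using disj by (auto simp: min_def max_def)
  next
    show "(\<lambda>(b, k, c). (min b c, max b c, k)) ` (B \<times> {..<m} \<times> C) \<subseteq> ?E"
    proof (rule image_subsetI)
      fix x assume "x \<in> B \<times> {..<m} \<times> C"
      then obtain b k c where x: "x = (b, k, c)" and "b \<in> B" "k < m" "c \<in> C" by blast
      moreover from this have "b \<noteq> c" "b \<in> {1..n}" "c \<in> {1..n}"
        using disj block_subset[OF B] block_subset[OF C] by auto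
      ultimately have "(min b c, max b c, k) \<in> ?E"
        using merged_vertex_block[OF B] merged_vertex_block[OF C]
        by (auto simp: edges_contraction ends_contraction min_def max_def)
      then show "(\<lambda>(b, k, c). (min b c, max b c, k)) x \<in> ?E" by (simp only: x prod.case)
    qed
  next
    have E: "k < m \<and> i < j \<and> (i \<in> B \<and> j \<in> C \<or> i \<notin> B \<and> i \<in> C \<and> j \<in> B)" if "(i, j, k) \<in> ?E" for i j k
    proof -
      have en: "{merged_vertex P i, merged_vertex P j} = {B, C}"
        using that by (simp add: ends_contraction)
      have "i \<noteq> 0"
      proof
        assume "i = 0"
        then have "{0} \<in> {B, C}" using en merged_vertex_zero by auto
        then show False using B C zero_not_block by auto
      qed
      then have ij: "i \<in> {1..n}" "j \<in> {1..n}" "i < j" "k < m"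
        using that by (auto simp: edges_contraction)
      then show ?thesis
        using en merged_vertex_eq_block_iff(2)[OF ij(1) B] merged_vertex_eq_block_iff(2)[OF ij(1) C]
          merged_vertex_eq_block_iff(2)[OF ij(2) B] merged_vertex_eq_block_iff(2)[OF ij(2) C] disj
        by (auto simp: doubleton_eq_iff)
    qed
    show "\<forall>e\<in>?E. (\<lambda>(b, k, c). (min b c, max b c, k))
        ((\<lambda>(i, j, k). if i \<in> B then (i, k, j) else (j, k, i)) e) = e"
    proof
      fix e assume e: "e \<in> ?E"
      obtain i j k where ijk: "e = (i, j, k)" by (metis surj_pair)
      have "i < j" using E e unfolding ijk by blast
      then show "(\<lambda>(b, k, c). (min b c, max b c, k))
        ((\<lambda>(i, j, k). if i \<in> B then (i, k, j) else (j, k, i)) e) = e"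
        by (simp add: ijk)
    qed
    show "(\<lambda>(i, j, k). if i \<in> B then (i, k, j) else (j, k, i)) ` ?E \<subseteq> B \<times> {..<m} \<times> C"
    proof (rule image_subsetI)
      fix e assume e: "e \<in> ?E"
      obtain i j k where ijk: "e = (i, j, k)" by (metis surj_pair)
      show "(\<lambda>(i, j, k). if i \<in> B then (i, k, j) else (j, k, i)) e \<in> B \<times> {..<m} \<times> C"
        using E[of i j k] e unfolding ijk by (auto split: if_splits)
    qed
  qed
  from bij_betw_same_card[OF this] show ?thesis by (simp add: card_cartesian_product)
qed

text \<open>The number of edges from \<open>B\<close> to its parent is \<open>card B\<close> times a
  weight of the parent alone. The factors \<open>card B\<close> are common to all parent maps; the
  rest is the weighted forest sum with single root \<open>{0}\<close>.\<close>

lemma card_spanning_trees_contraction: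
  assumes "n \<ge> 1"
  shows "real (card (spanning_trees contraction))
    = real (\<Prod>B\<in>P. card B) * (real (m * n) + 1) ^ (card P - 1)"
proof -
  have fP: "finite P" using finite_elements[OF _ P] by simp
  have fB: "finite B" if "B \<in> P" for B using block_subset[OF that] finite_subset by blast
  have P0: "P \<noteq> {}" using partition_onD1[OF P] assms by auto
  define y where "y C = (if C = {0} then 1 else real (m * card C))" for C :: "nat set"
  have edges: "real (card {e \<in> edges contraction. ends contraction e = {B, p B}}) = real (card B) * y (p B)"
    if p: "p \<in> acyclic_maps {{0}} P" and B: "B \<in> P" for p B
  proof (cases "p B = {0}")
    case True
    then show ?thesis using card_edges_to_zero[OF B] by (simp add: y_def)
  next
    case False
    obtain d :: "nat set \<Rightarrow> nat" where pE: "p \<in> P \<rightarrow>\<^sub>E {{0}} \<union> P"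
      and d: "\<And>v. v \<in> P \<Longrightarrow> p v \<in> P \<Longrightarrow> d (p v) < d v"
      using p unfolding acyclic_maps_def by blast
    have pB: "p B \<in> P" using PiE_mem[OF pE B] False by blast
    \<comment> \<open>Heights rule out fixed points, so loops inside a block are never
      counted.\<close>
    then have "B \<noteq> p B" using d[OF B] by auto
    then show ?thesis using card_edges_between_blocks[OF B pB] False by (simp add: y_def)
  qed
  have A: "vertices contraction - {{0}} = P" using vertices_contraction zero_not_block by simp
  have "real (card (spanning_trees contraction))
      = (\<Sum>p\<in>acyclic_maps {{0}} P. \<Prod>B\<in>P. real (card {e \<in> edges contraction. ends contraction e = {B, p B}}))"
    using card_spanning_trees[of contraction "{0}", unfolded A] fP
    by (simp add: finite_edges_contraction well_formed_contraction vertices_contraction)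
  also have "\<dots> = (\<Sum>p\<in>acyclic_maps {{0}} P. (\<Prod>B\<in>P. real (card B)) * (\<Prod>B\<in>P. y (p B)))"
    using edges by (simp add: prod.distrib)
  also have "\<dots> = (\<Prod>B\<in>P. real (card B)) * (\<Sum>p\<in>acyclic_maps {{0}} P. \<Prod>B\<in>P. y (p B))"
    by (simp add: sum_distrib_left)
  also have "(\<Sum>p\<in>acyclic_maps {{0}} P. \<Prod>B\<in>P. y (p B))
      = sum y {{0}} * (sum y {{0}} + sum y P) ^ (card P - 1)"
    using fP P0 zero_not_block by (intro sum_acyclic_maps) (auto simp: y_def)
  also have "sum y P = real m * real n"
  proof -
    have "sum y P = (\<Sum>B\<in>P. real m * real (card B))"
      using zero_not_block by (intro sum.cong) (auto simp: y_def)
    also have "\<dots> = real m * real (\<Sum>B\<in>P. card B)" by (simp add: sum_distrib_left)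
    also have "(\<Sum>B\<in>P. card B) = n" using product_partition[OF P fB] by simp
    finally show ?thesis .
  qed
  also have "sum y {{0}} = 1" by (simp add: y_def)
  finally show ?thesis by (simp add: add.commute)
qed

end

section \<open>Evaluation of the sum over partitions\<close>

theorem theoremA11:
  fixes m n :: nat
  assumes "n \<ge> 1"
  shows "1 / fact n *
      (\<Sum>P | partition_on {1..n} P.
         1 / real (\<Prod>S\<in>P. card S) * partition_mu n P *
         real (card (spanning_trees (contract_blocks (Gamma_graph m n) P))))
    = fuss_catalan m n"
proof -
  define x where "x = real (m * n) + 1"
  have x: "x > 0" by (simp add: x_def add_nonneg_pos)
  obtain l where n: "n = Suc l" using assms by (cases n) auto
  have summand: "1 / real (\<Prod>S\<in>P. card S) * partition_mu n P *
         real (card (spanning_trees (contract_blocks (Gamma_graph m n) P)))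
      = (\<Prod>S\<in>P. signed_block_weight x (card S)) / x" if P: "partition_on {1..n} P" for P
  proof -
    have fP: "finite P" using finite_elements[OF _ P] by simp
    have "P \<noteq> {}" using partition_onD1[OF P] assms by auto
    then have k: "card P > 0" using fP by (simp add: card_gt_0_iff)
    have "card S \<noteq> 0" if "S \<in> P" for S
      using that block_subset[OF P that] partition_onD3[OF P] finite_subset[of S "{1..n}"] by auto
    then have "real (\<Prod>S\<in>P. card S) \<noteq> 0" using fP by simp
    then have "1 / real (\<Prod>S\<in>P. card S) * partition_mu n P *
         real (card (spanning_trees (contract_blocks (Gamma_graph m n) P)))
        = partition_mu n P * x ^ (card P - 1)"
      unfolding card_spanning_trees_contraction[OF P assms] x_def[symmetric] by simp
    \<comment> \<open>The falling factorial takes one \<open>x\<close> per block, the tree count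
      supplies one fewer; \<open>P\<close> is nonempty, so the exponent is not truncated.\<close>
    also have "\<dots> = partition_mu n P * x ^ card P / x"
      using k x by (cases "card P") simp_all
    finally show ?thesis by (simp only: partition_mu_times_power[OF P])
  qed
  have "(\<Sum>P | partition_on {1..n} P.
         1 / real (\<Prod>S\<in>P. card S) * partition_mu n P *
         real (card (spanning_trees (contract_blocks (Gamma_graph m n) P))))
      = (\<Sum>P | partition_on {1..n} P. (\<Prod>S\<in>P. signed_block_weight x (card S)) / x)"
    using summand by (intro sum.cong) auto
  also have "\<dots> = (\<Prod>i<n. x - real i) / x"
    using sum_partition_on_signed_block_weight[of "{1..n}" x] by (simp add: sum_divide_distrib[symmetric])
  \<comment> \<open>The factor at \<open>i = 0\<close> is \<open>x\<close> and cancels; since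
    \<open>x = m * n + 1\<close>, the shifted factor \<open>x - Suc i\<close> equals
    \<open>m * n - i\<close>.\<close>
  also have "\<dots> = (\<Prod>i<l. x - real (Suc i))"
    unfolding n prod.lessThan_Suc_shift using x by simp
  also have "\<dots> = (\<Prod>i<l. real (m * Suc l) - real i)"
    by (simp add: x_def n add_diff_eq)
  finally show ?thesis
    using prod_eq_fuss_catalan[of m l] by (simp add: n)
qed

end
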